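(* Let the one-period demand $D$ be exponentially distributed with mean $\mu$. For any $h,p>0$ and $0\le r<\mu$, let $U(r)=p(\mu-r)/h$ and let $\mathcal{H}^r$ be the bias of the constant order policy with order quantity $r$. For any state $\mathbf{x}_t$, if $q_{t+\tau}=\mathrm{P}^{U(r)}_t(\mathbf{x}_t)$, then $$q_{t+\tau}\in\operatorname{argmin}_{q\ge 0}\ \mathbb{E}\big[\mathcal{H}^r(J_{t+\tau-1}+q)\,\big|\,\mathbf{x}_t\big].$$
   Context: Lost sales inventory system. Periods are $t\in\mathbb{N}_0=\{0,1,2,\dots\}$; $\tau\in\mathbb{N}_0$ is the lead time, $h>0$ the holding cost and $p>0$ the lost sales penalty cost. Demands $D_0,D_1,\dots$ are i.i.d. nonnegative random variables distributed as $D$, with $\mu=\mathbb{E}[D]<\infty$. $q_t\ge 0$ is the order arriving at the start of period $t$; the order $q_{t+\tau}$ is placed in period $t$, before $D_t$ is observed. $I_t$ is the inventory at the start of period $t$ after receiving $q_t$. With $(x)^+=\max(0,x)$, the dynamics are $L_t=(D_t-I_t)^+$, $J_t=(I_t-D_t)^+$, $I_t=J_{t-1}+q_t$. The state in period $t$ is $\mathbf{x}_t=(I_t,q_{t+1},\dots,q_{t+\tau-1})\in\mathbb{R}_+^\tau$ (for $\tau=0$ it is the inventory $J_{t-1}$ before ordering). Given $\mathbf{x}_t$, $J_{t+\tau-1}$ is a function of $\mathbf{x}_t$ and $D_t,\dots,D_{t+\tau-1}$, which are independent of $\mathbf{x}_t$. The projected inventory level (PIL) policy $\mathrm{P}^U$,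 $U\ge0$, is $\mathrm{P}^U_t(\mathbf{x}_t)=(U-\mathbb{E}[J_{t+\tau-1}\mid\mathbf{x}_t])^+$. The bias $\mathcal{H}^r:[0,\infty)\to\mathbb{R}$ of the constant order policy (which always orders $r$) is the relative value function satisfying $\mathcal{H}^r(x)=\mathbb{E}_D\big[h(x-D)^++p(D-x)^++\mathcal{H}^r((x-D)^++r)\big]-g^r$ for $x\ge0$ and $\mathcal{H}^r(0)=0$, where $g^r$ is the long-run average cost per period (with cost $hJ_t+pL_t$ in period $t$) of that policy. For exponential demand it is $\mathcal{H}^r(x)=\frac{h}{2(\mu-r)}x^2-px$. *)

theory Defs
  imports "HOL-Probability.Probability"
begin

text \<open>
  Lost sales dynamics along one demand path \<^term>\<open>d\<close>: period 0 starts with inventory \<^term>\<open>i\<close> (its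
  arriving order already received), and \<^term>\<open>q k\<close> is the order arriving at the start of period
  \<^term>\<open>k\<close>, so \<^term>\<open>q 0\<close> is never used.
\<close>

primrec inventory :: "(nat \<Rightarrow> real) \<Rightarrow> (nat \<Rightarrow> real) \<Rightarrow> real \<Rightarrow> nat \<Rightarrow> real" where
  "inventory q d i 0 = i"
| "inventory q d i (Suc k) = max 0 (inventory q d i k - d k) + q (Suc k)"

definition leftover :: "(nat \<Rightarrow> real) \<Rightarrow> (nat \<Rightarrow> real) \<Rightarrow> real \<Rightarrow> nat \<Rightarrow> real" where
  "leftover q d i k = max 0 (inventory q d i k - d k)"

definition lost_sales :: "(nat \<Rightarrow> real) \<Rightarrow> (nat \<Rightarrow> real) \<Rightarrow> real \<Rightarrow> nat \<Rightarrow> real" where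
  "lost_sales q d i k = max 0 (d k - inventory q d i k)"

text \<open>
  A state is the list \<open>[I\<^sub>t, q\<^sub>t\<^sub>+\<^sub>1, \<dots>, q\<^sub>t\<^sub>+\<^sub>\<tau>\<^sub>-\<^sub>1]\<close>; for lead time 0 it is the one-element list holding
  the inventory \<open>J\<^sub>t\<^sub>-\<^sub>1\<close> before ordering.
\<close>

definition is_state :: "nat \<Rightarrow> real list \<Rightarrow> bool" where
  "is_state \<tau> x \<longleftrightarrow> length x = max 1 \<tau> \<and> (\<forall>y\<in>set x. 0 \<le> y)"

text \<open>
  \<open>J\<^sub>t\<^sub>+\<^sub>\<tau>\<^sub>-\<^sub>1\<close> as a function of the state \<^term>\<open>x\<close> in period \<^term>\<open>t\<close> and of \<open>D\<^sub>t, \<dots>, D\<^sub>t\<^sub>+\<^sub>\<tau>\<^sub>-\<^sub>1\<close>. These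
  demands are independent of the state, so conditional expectations given that the state is
  \<^term>\<open>x\<close> are plain expectations of functions of this random variable.
\<close>

definition projected_leftover ::
    "nat \<Rightarrow> (nat \<Rightarrow> 'a \<Rightarrow> real) \<Rightarrow> nat \<Rightarrow> real list \<Rightarrow> 'a \<Rightarrow> real" where
  "projected_leftover \<tau> D t x \<omega> =
     (if \<tau> = 0 then x ! 0 else leftover (\<lambda>k. x ! k) (\<lambda>k. D (t + k) \<omega>) (x ! 0) (\<tau> - 1))"

definition PIL_order ::
    "'a measure \<Rightarrow> nat \<Rightarrow> (nat \<Rightarrow> 'a \<Rightarrow> real) \<Rightarrow> real \<Rightarrow> nat \<Rightarrow> real list \<Rightarrow> real" where
  "PIL_order M \<tau> D U t x = max 0 (U - (\<integral>\<omega>. projected_leftover \<tau> D t x \<omega> \<partial>M))"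

text \<open>
  Expected cost of periods \<open>0, \<dots>, n - 1\<close> under the constant order policy with order quantity
  \<^term>\<open>r\<close>, when the inventory at the start of period 0, after receipt, is \<^term>\<open>x\<close>.
\<close>

definition constant_order_cost ::
    "'a measure \<Rightarrow> (nat \<Rightarrow> 'a \<Rightarrow> real) \<Rightarrow> real \<Rightarrow> real \<Rightarrow> real \<Rightarrow> nat \<Rightarrow> real \<Rightarrow> real" where
  "constant_order_cost M D h p r n x =
     (\<integral>\<omega>. (\<Sum>k<n. h * leftover (\<lambda>_. r) (\<lambda>k. D k \<omega>) x k
                 + p * lost_sales (\<lambda>_. r) (\<lambda>k. D k \<omega>) x k) \<partial>M)"

definition is_average_cost ::
    "'a measure \<Rightarrow> (nat \<Rightarrow> 'a \<Rightarrow> real) \<Rightarrow> real \<Rightarrow> real \<Rightarrow> real \<Rightarrow> real \<Rightarrow> bool" where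
  "is_average_cost M D h p r g \<longleftrightarrow>
     (\<forall>x\<ge>0. (\<lambda>n. constant_order_cost M D h p r n x / real n) \<longlonglongrightarrow> g)"

text \<open>
  The bias of the constant order policy: the solution of the average cost equation, normalised at 0,
  that is the relative value function, i.e. the limiting difference in total expected cost between
  starting in \<^term>\<open>x\<close> and starting in 0. The limit clause is needed to single out the bias: for
  exponential demand with mean \<open>\<mu> > r > 0\<close>, adding to it the real part of
  \<open>(exp (a x) - 1) / a - (exp (b x) - 1) / b\<close>, where \<open>a\<close> and \<open>b\<close> are nonzero complex roots
  of \<open>exp (s r) = 1 + s \<mu>\<close> that are neither equal nor conjugate,
  yields further normalised solutions of the same equation.
  Only the values of \<^term>\<open>H\<close> on the nonnegative reals matter; \<^term>\<open>D 0\<close> serves as the generic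
  one-period demand.
\<close>

definition is_bias ::
    "'a measure \<Rightarrow> (nat \<Rightarrow> 'a \<Rightarrow> real) \<Rightarrow> real \<Rightarrow> real \<Rightarrow> real \<Rightarrow> (real \<Rightarrow> real) \<Rightarrow> bool" where
  "is_bias M D h p r H \<longleftrightarrow>
     H 0 = 0
   \<and> (\<exists>g. is_average_cost M D h p r g
        \<and> (\<forall>x\<ge>0.
              integrable M (\<lambda>\<omega>. h * max 0 (x - D 0 \<omega>) + p * max 0 (D 0 \<omega> - x)
                                 + H (max 0 (x - D 0 \<omega>) + r))
            \<and> H x = (\<integral>\<omega>. h * max 0 (x - D 0 \<omega>) + p * max 0 (D 0 \<omega> - x)
                           + H (max 0 (x - D 0 \<omega>) + r) \<partial>M) - g))
   \<and> (\<forall>x\<ge>0. (\<lambda>n. constant_order_cost M D h p r n x - constant_order_cost M D h p r n 0)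
              \<longlonglongrightarrow> H x)"

end

theory Submission
  imports Defs
begin

text \<open>
  Let \<open>V x = h x\<^sup>2 / (2 (\<mu> - r)) - p x\<close>. By memorylessness \<open>V\<close> satisfies the average cost equation, so
  the expected cost of \<open>n\<close> periods started in \<open>x\<close> is \<open>V x\<close> minus the expected value of \<open>V\<close> at the
  inventory in period \<open>n\<close>, plus a multiple of \<open>n\<close>. Two paths driven by the same demands merge at the
  first stockout of the upper one, and \<open>r < \<mu>\<close> makes the contribution of paths that have not merged
  vanish exponentially fast; so the bias is \<open>V\<close> on the nonnegative reals. As \<open>V\<close> is quadratic, the
  expected bias after ordering \<open>q\<close> depends on the projected inventory only through its mean, and the
  PIL order minimises the resulting parabola over \<open>q \<ge> 0\<close>.
\<close>

section \<open>Square integrable random variables\<close>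

text \<open>The bias is quadratic, so second moments are what its expectations require. The class is
  stable under the sums, differences and positive parts from which the dynamics are built.\<close>

definition square_integrable :: "'a measure \<Rightarrow> ('a \<Rightarrow> real) \<Rightarrow> bool" where
  "square_integrable M X \<longleftrightarrow> X \<in> borel_measurable M \<and> integrable M (\<lambda>\<omega>. (X \<omega>)\<^sup>2)"

lemma square_integrable_bound:
  assumes "square_integrable M X" "Y \<in> borel_measurable M" "\<And>\<omega>. \<bar>Y \<omega>\<bar> \<le> \<bar>X \<omega>\<bar>"
  shows "square_integrable M Y"
  unfolding square_integrable_def
proof
  show "integrable M (\<lambda>\<omega>. (Y \<omega>)\<^sup>2)"
  proof (rule Bochner_Integration.integrable_bound)
    show "integrable M (\<lambda>\<omega>. (X \<omega>)\<^sup>2)"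
      using assms(1) by (simp add: square_integrable_def)
    show "AE \<omega> in M. norm ((Y \<omega>)\<^sup>2) \<le> norm ((X \<omega>)\<^sup>2)"
      using assms(3) by (simp add: abs_le_square_iff)
  qed (use assms(2) in measurable)
qed (fact assms(2))

lemma square_integrable_mult:
  assumes "square_integrable M X" "square_integrable M Y"
  shows "integrable M (\<lambda>\<omega>. X \<omega> * Y \<omega>)"
proof (rule Bochner_Integration.integrable_bound)
  show "integrable M (\<lambda>\<omega>. (X \<omega>)\<^sup>2 + (Y \<omega>)\<^sup>2)"
    using assms by (simp add: square_integrable_def)
  have "\<bar>a * b\<bar> \<le> a\<^sup>2 + b\<^sup>2" for a b :: real
  proof -
    have "2 * \<bar>a * b\<bar> \<le> a\<^sup>2 + b\<^sup>2"
      using sum_squares_bound[of "\<bar>a\<bar>" "\<bar>b\<bar>"] by (simp add: abs_mult)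
    then show ?thesis
      using abs_ge_zero[of "a * b"] by linarith
  qed
  then show "AE \<omega> in M. norm (X \<omega> * Y \<omega>) \<le> norm ((X \<omega>)\<^sup>2 + (Y \<omega>)\<^sup>2)"
    by simp
qed (use assms in \<open>auto simp: square_integrable_def\<close>)

lemma square_integrable_add:
  assumes "square_integrable M X" "square_integrable M Y"
  shows "square_integrable M (\<lambda>\<omega>. X \<omega> + Y \<omega>)"
  using assms square_integrable_mult[OF assms]
  by (auto simp: square_integrable_def power2_sum mult.assoc)

lemma square_integrable_diff:
  assumes "square_integrable M X" "square_integrable M Y"
  shows "square_integrable M (\<lambda>\<omega>. X \<omega> - Y \<omega>)"
  using assms square_integrable_mult[OF assms]
  by (auto simp: square_integrable_def power2_diff mult.assoc)

lemma square_integrable_pos_part: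
  assumes "square_integrable M X"
  shows "square_integrable M (\<lambda>\<omega>. max 0 (X \<omega>))"
  using assms by (rule square_integrable_bound) (use assms in \<open>auto simp: square_integrable_def\<close>)

lemma (in prob_space) square_integrable_const: "square_integrable M (\<lambda>_. c)"
  by (simp add: square_integrable_def)

lemma (in prob_space) square_integrable_integrable:
  assumes "square_integrable M X"
  shows "integrable M X"
  using square_integrable_mult[OF assms square_integrable_const[of 1]] by simp

section \<open>Sample paths\<close>

lemma inventory_nonneg:
  assumes "0 \<le> i" "\<And>j. 1 \<le> j \<Longrightarrow> j \<le> k \<Longrightarrow> 0 \<le> q j"
  shows "0 \<le> inventory q d i k"
  using assms by (induction k) auto

text \<open>The bound is strict: the inventory at the start of period \<open>k\<close> has not yet
  met the demand \<open>d k\<close>. This is the source of its independence from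
  \<open>D k\<close>.\<close>

lemma inventory_cong:
  assumes "\<And>j. j < k \<Longrightarrow> d j = d' j"
  shows "inventory q d i k = inventory q d' i k"
  using assms by (induction k) auto

text \<open>The whole demand path depends on the sample point, so that \<open>N\<close> can be the
  product space of demand vectors and \<open>d\<close> the identity.\<close>

lemma measurable_inventory:
  assumes "\<And>k. k < n \<Longrightarrow> (\<lambda>\<omega>. d \<omega> k) \<in> borel_measurable N"
  shows "(\<lambda>\<omega>. inventory q (d \<omega>) i n) \<in> borel_measurable N"
  using assms by (induction n) auto

text \<open>
  The paths started in \<open>x\<close> and in 0 merge at the first stockout of the upper one; until then the
  upper one has lost no sales.
\<close>

lemma inventory_coupling:
  assumes "0 \<le> x" "0 \<le> r"
  shows "inventory (\<lambda>_. r) d 0 n \<le> inventory (\<lambda>_. r) d x n \<and>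
    (inventory (\<lambda>_. r) d x n = inventory (\<lambda>_. r) d 0 n \<or>
     inventory (\<lambda>_. r) d x n = x + real n * r - (\<Sum>k<n. d k))"
  using assms by (induction n) (auto simp: max_def algebra_simps)

text \<open>The second-order Taylor polynomial bounds \<open>exp\<close> from below on nonnegative
  arguments. An exponential of the net inflow, unlike a polynomial, factorises over independent
  demands.\<close>

lemma quadratic_le_exp:
  fixes y a p \<theta> :: real
  assumes "0 \<le> y" "0 \<le> a" "0 \<le> p" "0 < \<theta>"
  shows "a * y\<^sup>2 + p * y \<le> (2 * a / \<theta>\<^sup>2 + p / \<theta>) * exp (\<theta> * y)"
proof -
  have e: "1 + \<theta> * y + (\<theta> * y)\<^sup>2 / 2 \<le> exp (\<theta> * y)"
    using assms by (intro exp_lower_Taylor_quadratic) auto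
  have "\<theta> * y \<le> exp (\<theta> * y)" "(\<theta> * y)\<^sup>2 \<le> 2 * exp (\<theta> * y)"
    using e assms zero_le_power2[of "\<theta> * y"] mult_nonneg_nonneg[of \<theta> y] by linarith+
  then have "y \<le> exp (\<theta> * y) / \<theta>" "y\<^sup>2 \<le> 2 * exp (\<theta> * y) / \<theta>\<^sup>2"
    using assms by (simp_all add: field_simps)
  then have "a * y\<^sup>2 + p * y \<le> a * (2 * exp (\<theta> * y) / \<theta>\<^sup>2) + p * (exp (\<theta> * y) / \<theta>)"
    using assms by (intro add_mono mult_left_mono)
  then show ?thesis
    by (simp add: algebra_simps)
qed

text \<open>This is \<open>V\<close> when \<open>a = h / (2 * (\<mu> - r))\<close>. The cost
  identities below see \<open>a\<close> only through \<open>h = 2 * a * (\<mu> - r)\<close>, which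
  avoids division.\<close>

definition quadratic_bias :: "real \<Rightarrow> real \<Rightarrow> real \<Rightarrow> real" where
  "quadratic_bias a p x = a * x\<^sup>2 - p * x"

text \<open>Merged paths contribute nothing. Otherwise the upper path has the explicit form without
  lost sales and dominates the nonnegative lower one, so its own quadratic and linear terms bound
  the gap. The bound holds on every path, with no reference to the merging time.\<close>

lemma quadratic_bias_coupling:
  assumes "0 \<le> x" "0 \<le> r" "0 \<le> a" "0 \<le> p" "0 < \<theta>"
  shows "\<bar>quadratic_bias a p (inventory (\<lambda>_. r) d x n) - quadratic_bias a p (inventory (\<lambda>_. r) d 0 n)\<bar>
    \<le> (2 * a / \<theta>\<^sup>2 + p / \<theta>) * exp (\<theta> * (x + real n * r - (\<Sum>k<n. d k)))"
    (is "\<bar>quadratic_bias a p ?u - quadratic_bias a p ?l\<bar> \<le> ?K * exp (\<theta> * ?y)")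
proof (cases "?u = ?l")
  case False
  then have y: "?u = ?y" and lu: "?l \<le> ?u"
    using inventory_coupling[OF assms(1,2), of d n] by auto
  have l: "0 \<le> ?l"
    by (rule inventory_nonneg) (use assms in auto)
  have "?l\<^sup>2 \<le> ?u\<^sup>2"
    using l lu by (intro power_mono)
  then have "\<bar>a * (?u\<^sup>2 - ?l\<^sup>2)\<bar> \<le> a * ?u\<^sup>2" "\<bar>p * (?u - ?l)\<bar> \<le> p * ?u"
    using l lu assms by (auto simp: abs_mult intro!: mult_left_mono)
  then have "\<bar>quadratic_bias a p ?u - quadratic_bias a p ?l\<bar> \<le> a * ?u\<^sup>2 + p * ?u"
    unfolding quadratic_bias_def by (simp add: algebra_simps)
  also have "\<dots> \<le> ?K * exp (\<theta> * ?u)"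
    using l lu assms by (intro quadratic_le_exp) auto
  finally show ?thesis
    unfolding y .
qed (use assms in simp)

section \<open>Exponential demand\<close>

locale exponential_demand = prob_space M for M :: "'a measure" +
  fixes D :: "nat \<Rightarrow> 'a \<Rightarrow> real" and \<mu> :: real
  assumes indep: "indep_vars (\<lambda>_. borel) D UNIV"
    and exponential: "\<And>k. distributed M lborel (D k) (exponential_density (1 / \<mu>))"
    and mean_pos: "0 < \<mu>"
begin

section \<open>Moments and Laplace transform of the demand\<close>

lemma measurable_demand [measurable]: "D k \<in> borel_measurable M"
  using distributed_measurable[OF exponential] by simp

lemma square_integrable_demand: "square_integrable M (D k)"
  \<comment> \<open>The exponential density is the Erlang density of shape 0.\<close>
  using erlang_ith_moment_integrable[OF _ exponential, of k 2] mean_pos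
  by (simp add: square_integrable_def)

lemma expectation_demand: "(\<integral>\<omega>. D k \<omega> \<partial>M) = \<mu>"
  using exponential_distributed_expectation[OF _ exponential] mean_pos by simp

lemma expectation_demand_square: "(\<integral>\<omega>. (D k \<omega>)\<^sup>2 \<partial>M) = 2 * \<mu>\<^sup>2"
  using erlang_ith_moment[OF _ exponential, of k 2] mean_pos by (simp add: power_divide)

lemma AE_demand_nonneg: "AE \<omega> in M. 0 \<le> D k \<omega>"
  by (subst distributed_AE2[OF exponential]) (auto simp: exponential_density_def)

lemma integrable_exp_demand:
  assumes "0 \<le> \<theta>"
  shows "integrable M (\<lambda>\<omega>. exp (- \<theta> * D k \<omega>))"
  by (rule integrable_const_bound[where B = 1]) (use AE_demand_nonneg[of k] assms in auto)

lemma expectation_exp_demand: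
  assumes "0 \<le> \<theta>"
  shows "(\<integral>\<omega>. exp (- \<theta> * D k \<omega>) \<partial>M) = 1 / (1 + \<theta> * \<mu>)"
proof -
  define l where "l = 1 / \<mu>"
  have l: "0 < l" "0 < l + \<theta>"
    using mean_pos assms by (auto simp: l_def intro: add_pos_nonneg)
  interpret E: prob_space "density lborel (exponential_density (l + \<theta>))"
    using l by (intro prob_space_exponential_density)
  \<comment> \<open>Multiplying the density of rate \<open>l\<close> by
    \<open>exp (- \<theta> * y)\<close> gives \<open>l / (l + \<theta>)\<close> times the density of
    rate \<open>l + \<theta>\<close>, whose total mass is 1.\<close>
  have total: "(\<integral>y. exponential_density (l + \<theta>) y \<partial>lborel) = 1"
    using integral_real_density[of "exponential_density (l + \<theta>)" lborel "\<lambda>_. 1"]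
      E.prob_space l by (simp add: exponential_density_nonneg)
  have "(\<integral>\<omega>. exp (- \<theta> * D k \<omega>) \<partial>M) = (\<integral>y. exponential_density l y * exp (- \<theta> * y) \<partial>lborel)"
    using l by (intro distributed_integral[OF exponential[folded l_def], symmetric] exponential_density_nonneg) auto
  also have "\<dots> = (\<integral>y. l / (l + \<theta>) * exponential_density (l + \<theta>) y \<partial>lborel)"
    using l by (intro Bochner_Integration.integral_cong)
      (auto simp: exponential_density_def mult_exp_exp field_simps)
  also have "\<dots> = l / (l + \<theta>)"
    using total by simp
  also have "\<dots> = 1 / (1 + \<theta> * \<mu>)"
    using mean_pos by (simp add: l_def field_simps)
  finally show ?thesis .
qed

text \<open>The exponential of the sum is a product of independent factors, so each period
  multiplies the mean by \<open>exp (\<theta> * r) / (1 + \<theta> * \<mu>)\<close>.\<close>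

lemma
  assumes "0 \<le> \<theta>"
  shows integrable_exp_cumulative: "integrable M (\<lambda>\<omega>. exp (\<theta> * (x + real n * r - (\<Sum>k<n. D k \<omega>))))"
    and expectation_exp_cumulative:
      "(\<integral>\<omega>. exp (\<theta> * (x + real n * r - (\<Sum>k<n. D k \<omega>))) \<partial>M)
        = exp (\<theta> * x) * (exp (\<theta> * r) / (1 + \<theta> * \<mu>)) ^ n"
proof -
  have ind: "indep_vars (\<lambda>_. borel) (\<lambda>k \<omega>. exp (- \<theta> * D k \<omega>)) {..<n}"
    by (rule indep_vars_compose2[OF indep_vars_subset[OF indep]]) auto
  have eq: "exp (\<theta> * (x + real n * r - (\<Sum>k<n. D k \<omega>)))
      = exp (\<theta> * x) * exp (\<theta> * r) ^ n * (\<Prod>k<n. exp (- \<theta> * D k \<omega>))" for \<omega>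
    by (simp add: exp_sum[symmetric] exp_of_nat_mult[symmetric] exp_add[symmetric]
        sum_negf sum_distrib_left[symmetric] algebra_simps)
  show "integrable M (\<lambda>\<omega>. exp (\<theta> * (x + real n * r - (\<Sum>k<n. D k \<omega>))))"
    unfolding eq using indep_vars_integrable[OF _ ind] integrable_exp_demand[OF assms] by auto
  have "(\<integral>\<omega>. (\<Prod>k<n. exp (- \<theta> * D k \<omega>)) \<partial>M) = (1 / (1 + \<theta> * \<mu>)) ^ n"
    using indep_vars_lebesgue_integral[OF _ ind] integrable_exp_demand[OF assms]
      expectation_exp_demand[OF assms] by simp
  then show "(\<integral>\<omega>. exp (\<theta> * (x + real n * r - (\<Sum>k<n. D k \<omega>))) \<partial>M)
      = exp (\<theta> * x) * (exp (\<theta> * r) / (1 + \<theta> * \<mu>)) ^ n"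
    unfolding eq by (simp add: power_divide)
qed

section \<open>Memorylessness\<close>

lemma expectation_memoryless:
  fixes g :: "real \<Rightarrow> real"
  assumes [measurable]: "g \<in> borel_measurable borel" and g: "\<And>z. z < 0 \<Longrightarrow> g z = 0" and "0 \<le> i"
  shows "(\<integral>\<omega>. g (D k \<omega> - i) \<partial>M) = exp (- i / \<mu>) * (\<integral>\<omega>. g (D k \<omega>) \<partial>M)"
proof -
  let ?f = "exponential_density (1 / \<mu>)"
  have nonneg: "0 \<le> ?f y" for y
    using mean_pos by (simp add: exponential_density_nonneg)
  have "(\<integral>\<omega>. g (D k \<omega> - i) \<partial>M) = (\<integral>y. ?f y * g (y - i) \<partial>lborel)"
    using nonneg by (intro distributed_integral[OF exponential, symmetric]) auto
  also have "\<dots> = (\<integral>y. ?f (i + y) * g y \<partial>lborel)"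
    using lborel_integral_real_affine[of 1 "\<lambda>y. ?f y * g (y - i)" i] by simp
  \<comment> \<open>For negative \<open>y\<close> both integrands vanish with \<open>g\<close>; for
    \<open>y \<ge> 0\<close> also \<open>i + y \<ge> 0\<close>, so the shift in the density splits
    off as a factor.\<close>
  also have "\<dots> = (\<integral>y. exp (- i / \<mu>) * (?f y * g y) \<partial>lborel)"
    using g \<open>0 \<le> i\<close> by (intro Bochner_Integration.integral_cong)
      (auto simp: exponential_density_def mult_exp_exp diff_divide_distrib)
  also have "\<dots> = exp (- i / \<mu>) * (\<integral>\<omega>. g (D k \<omega>) \<partial>M)"
    using nonneg by (simp add: distributed_integral[OF exponential])
  finally show ?thesis .
qed

text \<open>
  Given that it is positive, the excess of the demand over an independent level is again exponential
  with mean \<open>\<mu>\<close>; hence the ratio of its first two moments does not depend on the level.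
\<close>

lemma expectation_excess_square:
  assumes ind: "indep_var borel X borel (D k)" and X: "square_integrable M X"
    and nonneg: "\<And>\<omega>. 0 \<le> X \<omega>"
  shows "(\<integral>\<omega>. (max 0 (D k \<omega> - X \<omega>))\<^sup>2 \<partial>M) = 2 * \<mu> * (\<integral>\<omega>. max 0 (D k \<omega> - X \<omega>) \<partial>M)"
proof -
  \<comment> \<open>The weights make the mean of \<open>g\<close> under the demand
    \<open>2 * \<mu>\<^sup>2 - 2 * \<mu> * \<mu> = 0\<close>. Memorylessness carries this zero to
    every fixed level \<open>i \<ge> 0\<close>; it remains to pass to the random level
    \<open>X\<close>.\<close>
  define g :: "real \<Rightarrow> real" where "g z = (max 0 z)\<^sup>2 - 2 * \<mu> * max 0 z" for z
  have [measurable]: "g \<in> borel_measurable borel"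
    unfolding g_def by measurable
  have [measurable]: "X \<in> borel_measurable M"
    using X by (simp add: square_integrable_def)
  have "square_integrable M (\<lambda>\<omega>. max 0 (D k \<omega> - X \<omega>))"
    by (intro square_integrable_pos_part square_integrable_diff X square_integrable_demand)
  then have L: "integrable M (\<lambda>\<omega>. (max 0 (D k \<omega> - X \<omega>))\<^sup>2)"
      "integrable M (\<lambda>\<omega>. max 0 (D k \<omega> - X \<omega>))"
    by (auto simp: square_integrable_integrable square_integrable_def)
  have int_g: "integrable M (\<lambda>\<omega>. g (D k \<omega> - X \<omega>))"
    unfolding g_def using L by simp
  have "(\<integral>\<omega>. g (D k \<omega>) \<partial>M) = (\<integral>\<omega>. (D k \<omega>)\<^sup>2 - 2 * \<mu> * D k \<omega> \<partial>M)"
    by (intro integral_cong_AE) (use AE_demand_nonneg[of k] in \<open>auto simp: g_def max_def\<close>)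
  also have "\<dots> = 0"
    using square_integrable_demand[of k] square_integrable_integrable[OF square_integrable_demand, of k]
    by (simp add: square_integrable_def expectation_demand expectation_demand_square)
      (simp add: power2_eq_square)
  finally have zero: "(\<integral>\<omega>. g (D k \<omega> - i) \<partial>M) = 0" if "0 \<le> i" for i
    using that by (subst expectation_memoryless) (auto simp: g_def)
  \<comment> \<open>Independence makes the joint law a product; Fubini then integrates first over
    the demand at a frozen level, where \<open>zero\<close> applies.\<close>
  have prod: "distr M borel X \<Otimes>\<^sub>M distr M borel (D k)
      = distr M (borel \<Otimes>\<^sub>M borel) (\<lambda>\<omega>. (X \<omega>, D k \<omega>))"
    using ind indep_var_distribution_eq[of borel X borel "D k"] by blast
  interpret P1: prob_space "distr M borel X"
    by (rule prob_space_distr) simp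
  interpret P2: prob_space "distr M borel (D k)"
    by (rule prob_space_distr) simp
  interpret P: pair_sigma_finite "distr M borel X" "distr M borel (D k)" ..
  have "(\<integral>\<omega>. g (D k \<omega> - X \<omega>) \<partial>M)
      = (\<integral>z. g (snd z - fst z) \<partial>distr M (borel \<Otimes>\<^sub>M borel) (\<lambda>\<omega>. (X \<omega>, D k \<omega>)))"
    by (subst integral_distr) auto
  also have "\<dots> = (\<integral>z. g (snd z - fst z) \<partial>(distr M borel X \<Otimes>\<^sub>M distr M borel (D k)))"
    by (simp add: prod)
  also have "\<dots> = (\<integral>i. (\<integral>d. g (d - i) \<partial>distr M borel (D k)) \<partial>distr M borel X)"
  proof (subst P.integral_fst'[symmetric])
    show "integrable (distr M borel X \<Otimes>\<^sub>M distr M borel (D k)) (\<lambda>z. g (snd z - fst z))"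
      unfolding prod using int_g by (subst integrable_distr_eq) auto
  qed simp
  also have "\<dots> = (\<integral>\<omega>. (\<integral>\<omega>'. g (D k \<omega>' - X \<omega>) \<partial>M) \<partial>M)"
    by (subst integral_distr) (auto simp: integral_distr)
  also have "\<dots> = 0"
    using zero nonneg by simp
  finally show ?thesis
    unfolding g_def using L by simp
qed

section \<open>Moments and independence along the path\<close>

lemma square_integrable_inventory:
  "square_integrable M (\<lambda>\<omega>. inventory q (\<lambda>k. D (t + k) \<omega>) i n)"
proof (induction n)
  case (Suc n)
  have "square_integrable M
      (\<lambda>\<omega>. max 0 (inventory q (\<lambda>k. D (t + k) \<omega>) i n - D (t + n) \<omega>) + q (Suc n))"
    by (intro square_integrable_add square_integrable_pos_part square_integrable_diff Suc
        square_integrable_demand square_integrable_const)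
  then show ?case
    by simp
qed (simp add: square_integrable_const)

lemma square_integrable_leftover:
  "square_integrable M (\<lambda>\<omega>. leftover q (\<lambda>k. D (t + k) \<omega>) i n)"
  unfolding leftover_def
  by (intro square_integrable_pos_part square_integrable_diff square_integrable_demand
      square_integrable_inventory)

lemma square_integrable_projected_leftover: "square_integrable M (projected_leftover \<tau> D t x)"
  unfolding projected_leftover_def
  by (cases "\<tau> = 0") (simp_all add: square_integrable_const square_integrable_leftover)

text \<open>The inventory in period \<open>n\<close> is a function of the demands indexed by
  \<open>{..<n}\<close>, a set disjoint from \<open>{n}\<close>.\<close>

lemma indep_inventory_demand: "indep_var borel (\<lambda>\<omega>. inventory q (\<lambda>k. D k \<omega>) i n) borel (D n)"
proof -
  let ?f = "\<lambda>d. inventory q d i n"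
  have f: "?f \<in> borel_measurable (PiM {..<n} (\<lambda>_. borel))"
    by (rule measurable_inventory) (auto intro: measurable_component_singleton)
  have "indep_var borel (?f \<circ> (\<lambda>\<omega>. restrict (\<lambda>k. D k \<omega>) {..<n}))
      borel ((\<lambda>d. d n) \<circ> (\<lambda>\<omega>. restrict (\<lambda>k. D k \<omega>) {n}))"
    by (rule indep_var_compose[OF indep_var_restrict[OF indep] f]) auto
  moreover have "?f \<circ> (\<lambda>\<omega>. restrict (\<lambda>k. D k \<omega>) {..<n}) = (\<lambda>\<omega>. inventory q (\<lambda>k. D k \<omega>) i n)"
    by (auto simp: fun_eq_iff intro: inventory_cong)
  moreover have "(\<lambda>d. d n) \<circ> (\<lambda>\<omega>. restrict (\<lambda>k. D k \<omega>) {n}) = D n"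
    by (simp add: fun_eq_iff)
  ultimately show ?thesis
    by simp
qed

section \<open>Expected cost of the constant order policy\<close>

lemma integrable_quadratic_bias:
  assumes "square_integrable M X"
  shows "integrable M (\<lambda>\<omega>. quadratic_bias a p (X \<omega>))"
  using square_integrable_integrable[OF assms] assms
  by (simp add: quadratic_bias_def square_integrable_def)

text \<open>The average cost equation, integrated along the path of the constant order policy.\<close>

lemma expected_quadratic_bias_Suc:
  assumes "0 \<le> x" "0 \<le> r" "h = 2 * a * (\<mu> - r)"
  defines "I \<equiv> \<lambda>n \<omega>. inventory (\<lambda>_. r) (\<lambda>k. D k \<omega>) x n"
  shows "(\<integral>\<omega>. quadratic_bias a p (I (Suc n) \<omega>) \<partial>M) = (\<integral>\<omega>. quadratic_bias a p (I n \<omega>) \<partial>M)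
    - (\<integral>\<omega>. h * leftover (\<lambda>_. r) (\<lambda>k. D k \<omega>) x n + p * lost_sales (\<lambda>_. r) (\<lambda>k. D k \<omega>) x n \<partial>M)
    + (p * (\<mu> - r) + a * r\<^sup>2)"
proof -
  define J where "J \<omega> = max 0 (I n \<omega> - D n \<omega>)" for \<omega>
  define L where "L \<omega> = max 0 (D n \<omega> - I n \<omega>)" for \<omega>
  have sqI: "square_integrable M (I n)"
    using square_integrable_inventory[of "\<lambda>_. r" 0 x n] by (simp add: I_def)
  have sqJ: "square_integrable M J" and sqL: "square_integrable M L"
    unfolding J_def L_def
    by (intro square_integrable_pos_part square_integrable_diff sqI square_integrable_demand)+
  note int1 = sqI[THEN square_integrable_integrable] sqJ[THEN square_integrable_integrable]
    sqL[THEN square_integrable_integrable] square_integrable_demand[of n, THEN square_integrable_integrable]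
  have int2: "integrable M (\<lambda>\<omega>. (I n \<omega>)\<^sup>2)" "integrable M (\<lambda>\<omega>. (L \<omega>)\<^sup>2)" "integrable M (\<lambda>\<omega>. (D n \<omega>)\<^sup>2)"
    using sqI sqL square_integrable_demand[of n] by (simp_all add: square_integrable_def)
  have intID: "integrable M (\<lambda>\<omega>. I n \<omega> * D n \<omega>)"
    by (intro square_integrable_mult sqI square_integrable_demand)
  have ind: "indep_var borel (I n) borel (D n)"
    unfolding I_def by (rule indep_inventory_demand)
  have ID: "(\<integral>\<omega>. I n \<omega> * D n \<omega> \<partial>M) = (\<integral>\<omega>. I n \<omega> \<partial>M) * \<mu>"
    using indep_var_lebesgue_integral[OF ind] int1 by (simp add: expectation_demand)
  have LL: "(\<integral>\<omega>. (L \<omega>)\<^sup>2 \<partial>M) = 2 * \<mu> * (\<integral>\<omega>. L \<omega> \<partial>M)"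
    unfolding L_def
    by (rule expectation_excess_square[OF ind sqI]) (auto simp: I_def assms intro: inventory_nonneg)
  have "(\<integral>\<omega>. J \<omega> \<partial>M) = (\<integral>\<omega>. I n \<omega> - D n \<omega> + L \<omega> \<partial>M)"
    by (intro Bochner_Integration.integral_cong) (auto simp: J_def L_def)
  then have J: "(\<integral>\<omega>. J \<omega> \<partial>M) = (\<integral>\<omega>. I n \<omega> \<partial>M) - \<mu> + (\<integral>\<omega>. L \<omega> \<partial>M)"
    using int1 by (simp add: expectation_demand)
  \<comment> \<open>The next inventory is \<open>J + r\<close>. Since \<open>J - L\<close> is
    \<open>I n - D n\<close> and one of \<open>J\<close> and \<open>L\<close> is always 0, the
    square of \<open>J\<close> is that of \<open>I n - D n\<close> minus that of \<open>L\<close>,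
    and \<open>LL\<close> evaluates the latter.\<close>
  have "quadratic_bias a p (I (Suc n) \<omega>) = a * (I n \<omega>)\<^sup>2 - 2 * a * (I n \<omega> * D n \<omega>)
      + a * (D n \<omega>)\<^sup>2 - a * (L \<omega>)\<^sup>2 + (2 * a * r - p) * J \<omega> + (a * r\<^sup>2 - p * r)" for \<omega>
    unfolding I_def J_def L_def quadratic_bias_def
    by (simp add: max_def power2_eq_square algebra_simps)
  then have next_value: "(\<integral>\<omega>. quadratic_bias a p (I (Suc n) \<omega>) \<partial>M) = a * (\<integral>\<omega>. (I n \<omega>)\<^sup>2 \<partial>M)
      - 2 * a * ((\<integral>\<omega>. I n \<omega> \<partial>M) * \<mu>) + a * (2 * \<mu>\<^sup>2) - a * (2 * \<mu> * (\<integral>\<omega>. L \<omega> \<partial>M))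
      + (2 * a * r - p) * (\<integral>\<omega>. J \<omega> \<partial>M) + (a * r\<^sup>2 - p * r)"
    using int1 int2 intID by (simp add: ID LL expectation_demand_square prob_space)
  have current_value: "(\<integral>\<omega>. quadratic_bias a p (I n \<omega>) \<partial>M)
      = a * (\<integral>\<omega>. (I n \<omega>)\<^sup>2 \<partial>M) - p * (\<integral>\<omega>. I n \<omega> \<partial>M)"
    unfolding quadratic_bias_def using int1 int2 by simp
  have cost: "(\<integral>\<omega>. h * leftover (\<lambda>_. r) (\<lambda>k. D k \<omega>) x n
        + p * lost_sales (\<lambda>_. r) (\<lambda>k. D k \<omega>) x n \<partial>M)
      = h * (\<integral>\<omega>. J \<omega> \<partial>M) + p * (\<integral>\<omega>. L \<omega> \<partial>M)"
    using int1 by (simp add: leftover_def lost_sales_def J_def[abs_def] L_def[abs_def] I_def)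
  \<comment> \<open>By the choice of \<open>a\<close>, the means of \<open>I n\<close> and of
    \<open>L\<close> carry the coefficient \<open>- (h + p)\<close> on both sides; only the constant
    is left.\<close>
  show ?thesis
    unfolding next_value current_value cost unfolding J assms(3)
    by (simp add: algebra_simps power2_eq_square)
qed

text \<open>Telescoping: the expected cost of a period is the drop in the expected quadratic bias
  plus a constant that does not depend on \<open>x\<close>.\<close>

lemma constant_order_cost_eq:
  assumes "0 \<le> x" "0 \<le> r" "h = 2 * a * (\<mu> - r)"
  shows "constant_order_cost M D h p r n x = quadratic_bias a p x
    - (\<integral>\<omega>. quadratic_bias a p (inventory (\<lambda>_. r) (\<lambda>k. D k \<omega>) x n) \<partial>M)
    + real n * (p * (\<mu> - r) + a * r\<^sup>2)"
proof -
  let ?cost = "\<lambda>k \<omega>. h * leftover (\<lambda>_. r) (\<lambda>k. D k \<omega>) x k + p * lost_sales (\<lambda>_. r) (\<lambda>k. D k \<omega>) x k"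
  have "integrable M (\<lambda>\<omega>. leftover (\<lambda>_. r) (\<lambda>k. D k \<omega>) x k)"
      "integrable M (\<lambda>\<omega>. lost_sales (\<lambda>_. r) (\<lambda>k. D k \<omega>) x k)" for k
    using square_integrable_inventory[of "\<lambda>_. r" 0 x k] square_integrable_demand[of k]
    unfolding leftover_def lost_sales_def
    by (auto intro!: square_integrable_integrable square_integrable_pos_part square_integrable_diff)
  then have "constant_order_cost M D h p r n x = (\<Sum>k<n. \<integral>\<omega>. ?cost k \<omega> \<partial>M)"
    unfolding constant_order_cost_def by (subst Bochner_Integration.integral_sum) auto
  also have "\<dots> = quadratic_bias a p x
      - (\<integral>\<omega>. quadratic_bias a p (inventory (\<lambda>_. r) (\<lambda>k. D k \<omega>) x n) \<partial>M)
      + real n * (p * (\<mu> - r) + a * r\<^sup>2)"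
  proof (induction n)
    case (Suc n)
    then show ?case
      using expected_quadratic_bias_Suc[OF assms, of p n]
      by (simp add: algebra_simps del: inventory.simps)
  qed (simp add: prob_space)
  finally show ?thesis .
qed

section \<open>Identification of the bias\<close>

lemma ex_contraction_rate:
  assumes "0 \<le> r" "r < \<mu>"
  obtains \<theta> where "0 < \<theta>" "exp (\<theta> * r) / (1 + \<theta> * \<mu>) < 1"
proof -
  \<comment> \<open>This function vanishes at 0 with slope \<open>\<mu> - r > 0\<close>, so it is
    positive just to the right of 0.\<close>
  have "((\<lambda>\<theta>. 1 + \<theta> * \<mu> - exp (\<theta> * r)) has_real_derivative \<mu> - r) (at 0)"
    by (auto intro!: derivative_eq_intros)
  from DERIV_pos_inc_right[OF this] assms obtain d where
    d: "0 < d" "\<And>e. 0 < e \<Longrightarrow> e < d \<Longrightarrow> 0 < 1 + e * \<mu> - exp (e * r)"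
    by auto
  have "exp (d / 2 * r) < 1 + d / 2 * \<mu>"
    using d(2)[of "d / 2"] \<open>0 < d\<close> by simp
  moreover have "0 < 1 + d / 2 * \<mu>"
    using \<open>0 < d\<close> mean_pos by (simp add: add_pos_pos)
  ultimately show ?thesis
    using \<open>0 < d\<close> by (intro that[of "d / 2"]) (simp_all add: divide_less_eq)
qed

text \<open>The terms linear in \<open>n\<close> agree for both starting points and cancel. What is
  left beside the limit is the expected gap of the quadratic bias between the two coupled
  paths.\<close>

lemma constant_order_cost_diff_limit:
  assumes "0 \<le> x" "0 \<le> r" "r < \<mu>" "0 < h" "0 \<le> p"
  shows "(\<lambda>n. constant_order_cost M D h p r n x - constant_order_cost M D h p r n 0)
    \<longlonglongrightarrow> quadratic_bias (h / (2 * (\<mu> - r))) p x"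
proof -
  define a where "a = h / (2 * (\<mu> - r))"
  have a: "h = 2 * a * (\<mu> - r)" "0 \<le> a"
    using assms by (simp_all add: a_def divide_simps)
  obtain \<theta> where \<theta>: "0 < \<theta>" "exp (\<theta> * r) / (1 + \<theta> * \<mu>) < 1"
    using ex_contraction_rate assms by blast
  define K where "K = 2 * a / \<theta>\<^sup>2 + p / \<theta>"
  let ?V = "\<lambda>y n \<omega>. quadratic_bias a p (inventory (\<lambda>_. r) (\<lambda>k. D k \<omega>) y n)"
  let ?e = "\<lambda>n. (\<integral>\<omega>. ?V x n \<omega> \<partial>M) - (\<integral>\<omega>. ?V 0 n \<omega> \<partial>M)"
  have int: "integrable M (?V y n)" for y n
    using integrable_quadratic_bias[OF square_integrable_inventory[of "\<lambda>_. r" 0 y n]] by simp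
  have bound: "norm (?e n) \<le> K * (exp (\<theta> * x) * (exp (\<theta> * r) / (1 + \<theta> * \<mu>)) ^ n)" for n
  proof -
    have "norm (?e n) = \<bar>\<integral>\<omega>. ?V x n \<omega> - ?V 0 n \<omega> \<partial>M\<bar>"
      using int by simp
    also have "\<dots> \<le> (\<integral>\<omega>. \<bar>?V x n \<omega> - ?V 0 n \<omega>\<bar> \<partial>M)"
      by (rule integral_abs_bound)
    \<comment> \<open>The pathwise coupling bound; its mean is geometric in \<open>n\<close> with
      ratio below 1.\<close>
    also have "\<dots> \<le> (\<integral>\<omega>. K * exp (\<theta> * (x + real n * r - (\<Sum>k<n. D k \<omega>))) \<partial>M)"
      using assms a \<theta> int integrable_exp_cumulative[of \<theta> x n r]
        quadratic_bias_coupling[of x r a p \<theta>, folded K_def]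
      by (intro integral_mono) auto
    also have "\<dots> = K * (exp (\<theta> * x) * (exp (\<theta> * r) / (1 + \<theta> * \<mu>)) ^ n)"
      using expectation_exp_cumulative[of \<theta> x n r] \<theta> by simp
    finally show ?thesis .
  qed
  have "(\<lambda>n. (exp (\<theta> * r) / (1 + \<theta> * \<mu>)) ^ n) \<longlonglongrightarrow> 0"
    using \<theta> mean_pos by (intro LIMSEQ_power_zero) (simp add: add_pos_pos)
  then have "(\<lambda>n. K * (exp (\<theta> * x) * (exp (\<theta> * r) / (1 + \<theta> * \<mu>)) ^ n)) \<longlonglongrightarrow> 0"
    by (intro tendsto_mult_right_zero)
  moreover have "\<forall>\<^sub>F n in sequentially.
      norm (?e n) \<le> K * (exp (\<theta> * x) * (exp (\<theta> * r) / (1 + \<theta> * \<mu>)) ^ n)"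
    by (rule always_eventually) (rule allI, rule bound)
  ultimately have "?e \<longlonglongrightarrow> 0"
    by (rule Lim_null_comparison[rotated])
  from tendsto_diff[OF tendsto_const this]
  have "(\<lambda>n. quadratic_bias a p x - ?e n) \<longlonglongrightarrow> quadratic_bias a p x"
    by simp
  moreover have "constant_order_cost M D h p r n x - constant_order_cost M D h p r n 0
      = quadratic_bias a p x - ?e n" for n
    unfolding constant_order_cost_eq[OF \<open>0 \<le> x\<close> \<open>0 \<le> r\<close> a(1)]
      constant_order_cost_eq[OF order_refl \<open>0 \<le> r\<close> a(1)]
    by (simp add: quadratic_bias_def[of _ _ 0])
  ultimately show ?thesis
    by (simp add: a_def)
qed

text \<open>Both sides are limits of the same cost differences.\<close>

lemma bias_eq:
  assumes "is_bias M D h p r H" "0 \<le> x" "0 \<le> r" "r < \<mu>" "0 < h" "0 \<le> p"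
  shows "H x = quadratic_bias (h / (2 * (\<mu> - r))) p x"
proof -
  have "(\<lambda>n. constant_order_cost M D h p r n x - constant_order_cost M D h p r n 0) \<longlonglongrightarrow> H x"
    using assms unfolding is_bias_def by blast
  then show ?thesis
    using LIMSEQ_unique constant_order_cost_diff_limit[OF assms(2-)] by blast
qed

section \<open>Minimisation over the order quantity\<close>

lemma expected_quadratic_bias_shift:
  assumes "square_integrable M J"
  shows "(\<integral>\<omega>. quadratic_bias a p (J \<omega> + y) \<partial>M) = (\<integral>\<omega>. quadratic_bias a p (J \<omega>) \<partial>M)
    + (2 * a * (\<integral>\<omega>. J \<omega> \<partial>M) - p) * y + a * y\<^sup>2"
proof -
  \<comment> \<open>Expanding the square couples \<open>J\<close> and \<open>y\<close> only through
    a product linear in \<open>J\<close>, so only the mean of \<open>J\<close> meets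
    \<open>y\<close>.\<close>
  have "quadratic_bias a p (J \<omega> + y)
      = quadratic_bias a p (J \<omega>) + (2 * a * y) * J \<omega> + (a * y\<^sup>2 - p * y)" for \<omega>
    by (simp add: quadratic_bias_def power2_eq_square algebra_simps)
  then have "(\<integral>\<omega>. quadratic_bias a p (J \<omega> + y) \<partial>M)
      = (\<integral>\<omega>. quadratic_bias a p (J \<omega>) \<partial>M) + (2 * a * y) * (\<integral>\<omega>. J \<omega> \<partial>M) + (a * y\<^sup>2 - p * y)"
    using integrable_quadratic_bias[OF assms, of a p] square_integrable_integrable[OF assms]
    by (simp add: prob_space)
  then show ?thesis
    by (simp add: algebra_simps)
qed

end

text \<open>The parabola has its vertex at \<open>u\<close>. If \<open>u < 0\<close>, it increases
  on the nonnegative reals and the minimum sits at 0.\<close>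

lemma quadratic_min_nonneg:
  fixes a m u y :: real
  assumes "0 < a" "0 \<le> y"
  shows "a * (max 0 u)\<^sup>2 - 2 * a * u * max 0 u \<le> a * y\<^sup>2 - 2 * a * u * y"
proof (cases "0 \<le> u")
  case True
  have "0 \<le> a * (y - u)\<^sup>2"
    using assms by simp
  then show ?thesis
    using True by (simp add: power2_eq_square algebra_simps)
next
  case False
  then have "0 \<le> a * y\<^sup>2" "a * u * y \<le> 0"
    using assms by (auto simp: mult_nonneg_nonpos mult_nonpos_nonneg)
  then show ?thesis
    using False by simp
qed

theorem lemma3:
  fixes M :: "'a measure" and D :: "nat \<Rightarrow> 'a \<Rightarrow> real"
    and \<mu> h p r q :: real and \<tau> t :: nat and x :: "real list" and H :: "real \<Rightarrow> real"
  assumes "prob_space M"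
    and "prob_space.indep_vars M (\<lambda>_. borel) D UNIV"
    and "\<And>k. distributed M lborel (D k) (exponential_density (1 / \<mu>))"
    and "h > 0" and "p > 0" and "0 \<le> r" and "r < \<mu>"
    and "is_bias M D h p r H"
    and "is_state \<tau> x"
    and "q = PIL_order M \<tau> D (p * (\<mu> - r) / h) t x"
  shows "is_arg_min (\<lambda>q'. \<integral>\<omega>. H (projected_leftover \<tau> D t x \<omega> + q') \<partial>M) (\<lambda>q'. 0 \<le> q') q"
proof -
  interpret exponential_demand M D \<mu>
    unfolding exponential_demand_def exponential_demand_axioms_def using assms by auto
  define a where "a = h / (2 * (\<mu> - r))"
  let ?J = "projected_leftover \<tau> D t x"
  define m where "m = (\<integral>\<omega>. ?J \<omega> \<partial>M)"
  define u where "u = p * (\<mu> - r) / h - m"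
  have "0 < a"
    using assms by (simp add: a_def)
  \<comment> \<open>The level \<open>U(r)\<close> is the vertex \<open>p / (2 * a)\<close> of
    \<open>V\<close>, so the parabola in the order quantity has its vertex at \<open>u\<close>,
    which is \<open>U(r)\<close> minus the projected mean.\<close>
  have "2 * a * (p * (\<mu> - r) / h) = p"
    using assms by (simp add: a_def divide_simps)
  then have slope: "2 * a * m - p = - 2 * a * u"
    using right_diff_distrib[of "2 * a" "p * (\<mu> - r) / h" m] unfolding u_def by linarith
  \<comment> \<open>\<open>H\<close> is known only on the nonnegative reals. For lead time 0 the
    projected inventory is the state entry itself; otherwise it is a positive part.\<close>
  have "0 \<le> x ! 0"
    using \<open>is_state \<tau> x\<close> by (auto simp: is_state_def)
  then have "0 \<le> ?J \<omega>" for \<omega>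
    by (simp add: projected_leftover_def leftover_def)
  then have "(\<integral>\<omega>. H (?J \<omega> + y) \<partial>M) = (\<integral>\<omega>. quadratic_bias a p (?J \<omega> + y) \<partial>M)" if "0 \<le> y" for y
    using that assms unfolding a_def
    by (intro Bochner_Integration.integral_cong refl bias_eq) auto
  moreover have "(\<integral>\<omega>. quadratic_bias a p (?J \<omega> + y) \<partial>M)
      = (\<integral>\<omega>. quadratic_bias a p (?J \<omega>) \<partial>M) + (a * y\<^sup>2 - 2 * a * u * y)" for y
    unfolding expected_quadratic_bias_shift[OF square_integrable_projected_leftover] m_def[symmetric]
    by (simp add: slope)
  moreover have "q = max 0 u"
    using assms by (simp add: PIL_order_def u_def m_def)
  ultimately show ?thesis
    using quadratic_min_nonneg[OF \<open>0 < a\<close>] by (simp add: is_arg_min_linorder)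
qed

end
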